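(* Let $f=ax_1^{d_1}x_2^{d_2}\cdots x_n^{d_n}$ be a monomial, regarded as a function on $\mathbb{R}^n$, where $a\in\mathbb{R}$, $a \neq 0$ and $d_1,\dots,d_n$ are non-negative integers. The following are equivalent: (a) $f$ is g-convex with respect to some connection on $\mathbb{R}^n$. (b) $f$ is convex (in the usual sense). (c) $f=ax_j^{d_j}$ for some $1 \le j \le n$, where $a>0$ and $d_j$ is even.
   Context: A connection means a smooth torsion-free affine connection $\nabla$ ($\nabla_XY-\nabla_YX=[X,Y]$). A smooth function $f$ on a manifold $\mathcal{M}$ is g-convex with respect to $\nabla$ if $f\circ\gamma:[0,1]\to\mathbb{R}$ is convex for every $\nabla$-geodesic $\gamma:[0,1]\to\mathcal{M}$; equivalently, $\mathrm{Hess}_\nabla f(X,Y)=X(Y(f))-(\nabla_XY)(f)$ is positive semidefinite at every point.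
   Formalization: As printed, (b) does not imply (c): f = x_1 and f = -1 are convex and g-convex for the flat connection but violate (c). The formal version adds to (c) the alternatives "f has total degree 1" and "f is a negative constant"; (a) and (b) are unchanged. *)

theory Defs
  imports "HOL-Analysis.Analysis"
begin

text \<open>Iterated directional derivatives; over a finite-dimensional domain,
  \<^term>\<open>Ck k f\<close> says that \<^term>\<open>f\<close> is of class \<open>C\<^sup>k\<close> on the whole space.\<close>

primrec Ck :: "nat \<Rightarrow> ('a::real_normed_vector \<Rightarrow> 'b::real_normed_vector) \<Rightarrow> bool" where
  "Ck 0 f \<longleftrightarrow> continuous_on UNIV f"
| "Ck (Suc k) f \<longleftrightarrow> (\<forall>x. f differentiable (at x)) \<and>
     (\<forall>v. Ck k (\<lambda>x. frechet_derivative f (at x) v))"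

definition smooth :: "('a::real_normed_vector \<Rightarrow> 'b::real_normed_vector) \<Rightarrow> bool" where
  "smooth f \<longleftrightarrow> (\<forall>k. Ck k f)"

text \<open>The tangent bundle of \<open>\<real>\<^sup>n\<close> is trivialised by the coordinate frame, so vector fields are maps
  from \<open>\<real>\<^sup>n\<close> to itself.\<close>

type_synonym 'n vfield = "(real, 'n) vec \<Rightarrow> (real, 'n) vec"

definition vf_deriv :: "'n::finite vfield \<Rightarrow> (real ^ 'n \<Rightarrow> real) \<Rightarrow> real ^ 'n \<Rightarrow> real" where
  "vf_deriv X f p = frechet_derivative f (at p) (X p)"

definition lie_bracket :: "'n::finite vfield \<Rightarrow> 'n vfield \<Rightarrow> 'n vfield" where
  "lie_bracket X Y p = frechet_derivative Y (at p) (X p) - frechet_derivative X (at p) (Y p)"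

text \<open>Only the values of \<open>nabla\<close> on smooth fields are constrained (or used below).  Linearity over the
  reals in the second argument is the Leibniz rule for constant functions.\<close>

locale affine_connection =
  fixes nabla :: "'n::finite vfield \<Rightarrow> 'n vfield \<Rightarrow> 'n vfield"
  assumes smooth_nabla: "smooth X \<Longrightarrow> smooth Y \<Longrightarrow> smooth (nabla X Y)"
    and add_left: "smooth X \<Longrightarrow> smooth X' \<Longrightarrow> smooth Y \<Longrightarrow>
      nabla (\<lambda>p. X p + X' p) Y = (\<lambda>p. nabla X Y p + nabla X' Y p)"
    and scale_left: "smooth g \<Longrightarrow> smooth X \<Longrightarrow> smooth Y \<Longrightarrow>
      nabla (\<lambda>p. g p *\<^sub>R X p) Y = (\<lambda>p. g p *\<^sub>R nabla X Y p)"
    and add_right: "smooth X \<Longrightarrow> smooth Y \<Longrightarrow> smooth Y' \<Longrightarrow>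
      nabla X (\<lambda>p. Y p + Y' p) = (\<lambda>p. nabla X Y p + nabla X Y' p)"
    and leibniz: "smooth g \<Longrightarrow> smooth X \<Longrightarrow> smooth Y \<Longrightarrow>
      nabla X (\<lambda>p. g p *\<^sub>R Y p) = (\<lambda>p. vf_deriv X g p *\<^sub>R Y p + g p *\<^sub>R nabla X Y p)"

locale torsion_free_connection = affine_connection +
  assumes torsion_free: "smooth X \<Longrightarrow> smooth Y \<Longrightarrow>
      (\<lambda>p. nabla X Y p - nabla Y X p) = lie_bracket X Y"

text \<open>The vector \<open>christoffel nabla p i j\<close> has the Christoffel symbols
  \<open>\<Gamma>\<^sup>k\<^sub>i\<^sub>j(p)\<close>, for varying \<open>k\<close>, as its components.\<close>

definition christoffel ::
    "('n::finite vfield \<Rightarrow> 'n vfield \<Rightarrow> 'n vfield) \<Rightarrow> real ^ 'n \<Rightarrow> 'n \<Rightarrow> 'n \<Rightarrow> real ^ 'n" where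
  "christoffel nabla p i j = nabla (\<lambda>_. axis i 1) (\<lambda>_. axis j 1) p"

text \<open>The covariant derivative of the field \<open>V\<close> along the curve \<open>\<gamma>\<close> is
  \<open>V' + (\<Sum>i j. \<gamma>'\<^sub>i V\<^sub>j \<nabla>\<^bsub>e\<^sub>i\<^esub> e\<^sub>j)\<close>; a geodesic is a curve whose velocity \<open>v\<close> is parallel along it.
  Derivatives at \<open>0\<close> and \<open>1\<close> are one-sided.  Twice differentiable solutions of this equation are
  automatically smooth, so smoothness of \<open>\<gamma>\<close> is not a separate requirement.\<close>

definition geodesic ::
    "('n::finite vfield \<Rightarrow> 'n vfield \<Rightarrow> 'n vfield) \<Rightarrow> (real \<Rightarrow> real ^ 'n) \<Rightarrow> bool" where
  "geodesic nabla \<gamma> \<longleftrightarrow> (\<exists>v. \<forall>t\<in>{0..1}.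
     (\<gamma> has_vector_derivative v t) (at t within {0..1}) \<and>
     (v has_vector_derivative
        - (\<Sum>i\<in>UNIV. \<Sum>j\<in>UNIV. (v t $ i * v t $ j) *\<^sub>R christoffel nabla (\<gamma> t) i j))
       (at t within {0..1}))"

definition g_convex ::
    "('n::finite vfield \<Rightarrow> 'n vfield \<Rightarrow> 'n vfield) \<Rightarrow> (real ^ 'n \<Rightarrow> real) \<Rightarrow> bool" where
  "g_convex nabla f \<longleftrightarrow>
     smooth f \<and> (\<forall>\<gamma>. geodesic nabla \<gamma> \<longrightarrow> convex_on {0..1} (f \<circ> \<gamma>))"

end

theory Submission
  imports Defs
begin

text \<open>If \<open>f\<close> is g-convex, rescale around the origin.  Substituting \<open>\<gamma> = \<epsilon> u\<close> in the geodesic equation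
  multiplies the Christoffel symbols by \<open>\<epsilon>\<close>, so as \<open>\<epsilon> \<rightarrow> 0\<close> every straight segment is a uniform limit
  of curves \<open>u\<close> for which \<open>\<epsilon> u\<close> is a geodesic.  As \<open>f\<close> is homogeneous, it is convex along each such
  \<open>u\<close>, hence, in the limit, along every segment.  Conversely a convex function is g-convex for the flat
  connection.  A convex monomial of degree at least \<open>2\<close> has \<open>a > 0\<close> and even degree because of its
  restriction to the diagonal, and it cannot involve two variables \<open>x\<^sub>i\<close>, \<open>x\<^sub>j\<close>, since it would vanish
  at \<open>(1,\<dots>,1) \<plusminus> (e\<^sub>i - e\<^sub>j)\<close> but be positive at the midpoint \<open>(1,\<dots>,1)\<close>.\<close>

subsection \<open>Smooth maps and the flat connection\<close>

lemma Ck_Suc_imp_Ck: "Ck (Suc k) f \<Longrightarrow> Ck k f"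
proof (induction k arbitrary: f)
  case 0
  then show ?case
    by (auto intro!: differentiable_imp_continuous_on simp: differentiable_on_def
        differentiable_at_withinI)
next
  case (Suc k)
  then show ?case by (metis Ck.simps(2))
qed

text \<open>Derivatives are unique, so an explicitly known derivative may replace the chosen
  \<open>frechet_derivative\<close>. The closure lemmas below feed the usual differentiation rules
  into this and induct on \<open>k\<close>.\<close>

lemma Ck_SucI:
  assumes "\<And>x. (f has_derivative f' x) (at x)" "\<And>v. Ck k (\<lambda>x. f' x v)"
  shows "Ck (Suc k) f"
proof -
  have "frechet_derivative f (at x) = f' x" for x
    using frechet_derivative_at[OF assms(1)] by simp
  then show ?thesis using assms by (auto simp: differentiable_def)
qed

lemma Ck_SucD:
  assumes "Ck (Suc k) f"
  shows "(f has_derivative frechet_derivative f (at x)) (at x)"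
    and "Ck k (\<lambda>x. frechet_derivative f (at x) v)"
  using assms by (auto simp: frechet_derivative_works[symmetric])

lemma Ck_const: "Ck k (\<lambda>_. c)"
  by (induction k arbitrary: c) auto

lemma Ck_add: "Ck k f \<Longrightarrow> Ck k g \<Longrightarrow> Ck k (\<lambda>x. f x + g x)"
proof (induction k arbitrary: f g)
  case 0
  then show ?case by (auto intro: continuous_intros)
next
  case (Suc k)
  show ?case
    by (rule Ck_SucI[OF has_derivative_add[OF Ck_SucD(1)[OF Suc.prems(1)] Ck_SucD(1)[OF Suc.prems(2)]]])
      (intro Suc.IH Ck_SucD(2) Suc.prems)
qed

lemma Ck_sum: "(\<And>i. i \<in> I \<Longrightarrow> Ck k (f i)) \<Longrightarrow> Ck k (\<lambda>x. \<Sum>i\<in>I. f i x)"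
  by (induction I rule: infinite_finite_induct) (auto intro: Ck_const Ck_add)

text \<open>Differentiating in a fixed direction gives two terms of the same bilinear shape, each
  with one factor differentiated. Hence the induction runs over all \<open>f\<close> and
  \<open>g\<close>, and \<open>Ck_Suc_imp_Ck\<close> handles the undifferentiated factor. It serves
  both real products and scalar multiples of fields.\<close>

lemma Ck_bilinear:
  assumes "bounded_bilinear h" and "Ck k f" "Ck k g"
  shows "Ck k (\<lambda>x. h (f x) (g x))"
  using assms(2,3)
proof (induction k arbitrary: f g)
  case 0
  then show ?case by (auto intro: bounded_bilinear.continuous_on[OF assms(1)])
next
  case (Suc k)
  show ?case
    by (rule Ck_SucI[OF bounded_bilinear.FDERIV[OF assms(1)
            Ck_SucD(1)[OF Suc.prems(1)] Ck_SucD(1)[OF Suc.prems(2)]]])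
      (intro Ck_add Suc.IH Ck_SucD(2)[OF Suc.prems(1)] Ck_SucD(2)[OF Suc.prems(2)]
        Suc.prems[THEN Ck_Suc_imp_Ck])
qed

lemma Ck_linear_comp:
  assumes "bounded_linear L" "Ck k f"
  shows "Ck k (\<lambda>x. L (f x))"
  using assms(2)
proof (induction k arbitrary: f)
  case 0
  then show ?case by (auto intro: bounded_linear.continuous_on[OF assms(1)])
next
  case (Suc k)
  show ?case
    by (rule Ck_SucI[OF bounded_linear.has_derivative[OF assms(1) Ck_SucD(1)[OF Suc.prems]]])
      (intro Suc.IH Ck_SucD(2) Suc.prems)
qed

lemma Ck_ident: "Ck k (\<lambda>x. x)"
proof (cases k)
  case 0
  then show ?thesis by simp
next
  case (Suc m)
  then show ?thesis by (auto intro!: Ck_SucI[OF has_derivative_ident] Ck_const)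
qed

lemma smooth_monomial: "smooth (\<lambda>x::real^'n. a * (\<Prod>i\<in>UNIV. x $ i ^ d i))"
  unfolding smooth_def
proof
  fix k
  have coord: "Ck k (\<lambda>x::real^'n. x $ i)" for i
    using Ck_linear_comp[OF bounded_linear_vec_nth Ck_ident] .
  have mult: "Ck k (\<lambda>x. f x * g x)" if "Ck k f" "Ck k g" for f g :: "real^'n \<Rightarrow> real"
    using Ck_bilinear[OF bounded_bilinear_mult that] .
  have power: "Ck k (\<lambda>x::real^'n. x $ i ^ m)" for i m
    by (induction m) (auto intro: Ck_const mult coord)
  have "Ck k (\<lambda>x::real^'n. \<Prod>i\<in>I. x $ i ^ d i)" if "finite I" for I
    using that by induction (auto intro: Ck_const mult power)
  then show "Ck k (\<lambda>x::real^'n. a * (\<Prod>i\<in>UNIV. x $ i ^ d i))"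
    by (intro mult Ck_const) auto
qed

lemma smooth_has_derivative:
  "smooth f \<Longrightarrow> (f has_derivative frechet_derivative f (at x)) (at x)"
  unfolding smooth_def by (rule Ck_SucD(1)) blast

section \<open>The flat connection and its geodesics\<close>

text \<open>This is the Levi-Civita connection of the Euclidean metric; constant fields are
  parallel, so its Christoffel symbols vanish.\<close>

definition flat_connection :: "'n::finite vfield \<Rightarrow> 'n vfield \<Rightarrow> 'n vfield" where
  "flat_connection X Y p = frechet_derivative Y (at p) (X p)"

text \<open>\<open>Ck\<close> controls derivatives only in a fixed direction, while
  \<open>flat_connection\<close> differentiates along the varying \<open>X p\<close>. Expanding in
  the coordinate frame separates the two dependences on the point.\<close>

lemma frechet_derivative_coords:
  fixes f :: "real ^ 'n \<Rightarrow> 'b::real_normed_vector"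
  assumes "f differentiable at p"
  shows "frechet_derivative f (at p) v = (\<Sum>i\<in>UNIV. v $ i *\<^sub>R frechet_derivative f (at p) (axis i 1))"
proof -
  interpret linear "frechet_derivative f (at p)"
    using assms by (rule linear_frechet_derivative)
  have "frechet_derivative f (at p) (\<Sum>i\<in>UNIV. v $ i *\<^sub>R axis i 1) =
      (\<Sum>i\<in>UNIV. v $ i *\<^sub>R frechet_derivative f (at p) (axis i 1))"
    by (simp add: sum scale)
  moreover have "(\<Sum>i\<in>UNIV. v $ i *\<^sub>R axis i 1) = v"
    using basis_expansion[of v] by (simp add: scalar_mult_eq_scaleR)
  ultimately show ?thesis by simp
qed

lemma smooth_flat_connection:
  assumes "smooth X" "smooth Y"
  shows "smooth (flat_connection X Y)"
proof -
  have eq: "flat_connection X Y =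
      (\<lambda>p. \<Sum>i\<in>UNIV. X p $ i *\<^sub>R frechet_derivative Y (at p) (axis i 1))"
    unfolding flat_connection_def
    by (intro ext frechet_derivative_coords)
      (use smooth_has_derivative[OF assms(2)] in \<open>auto simp: differentiable_def\<close>)
  have "Ck k (\<lambda>p. X p $ i)" "Ck k (\<lambda>p. frechet_derivative Y (at p) v)" for k i v
    using assms Ck_linear_comp[OF bounded_linear_vec_nth, of k X i] Ck_SucD(2)[of k Y v]
    unfolding smooth_def by blast+
  then show ?thesis
    unfolding eq smooth_def by (intro allI Ck_sum Ck_bilinear[OF bounded_bilinear_scaleR])
qed

text \<open>The axioms reduce to linearity of the derivative in its direction, the sum rule and the
  product rule; the torsion identity is the coordinate formula for the bracket.\<close>

lemma torsion_free_flat_connection: "torsion_free_connection (flat_connection :: 'n::finite vfield \<Rightarrow> _)"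
proof
  note D = smooth_has_derivative
  have lin: "linear (frechet_derivative Y (at p))" if "smooth Y" for Y :: "'n vfield" and p
    using D[OF that] has_derivative_linear by blast
  show "flat_connection (\<lambda>p. X p + X' p) Y = (\<lambda>p. flat_connection X Y p + flat_connection X' Y p)"
    if "smooth Y" for X X' Y :: "'n vfield"
    using lin[OF that] by (simp add: flat_connection_def fun_eq_iff linear_add)
  show "flat_connection (\<lambda>p. g p *\<^sub>R X p) Y = (\<lambda>p. g p *\<^sub>R flat_connection X Y p)"
    if "smooth Y" for g and X Y :: "'n vfield"
    using lin[OF that] by (simp add: flat_connection_def fun_eq_iff linear_scale)
  show "flat_connection X (\<lambda>p. Y p + Y' p) = (\<lambda>p. flat_connection X Y p + flat_connection X Y' p)"
    if "smooth Y" "smooth Y'" for X Y Y' :: "'n vfield"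
    unfolding flat_connection_def
      frechet_derivative_at[OF has_derivative_add[OF D[OF that(1)] D[OF that(2)]], symmetric]
    by simp
  show "flat_connection X (\<lambda>p. g p *\<^sub>R Y p) =
      (\<lambda>p. vf_deriv X g p *\<^sub>R Y p + g p *\<^sub>R flat_connection X Y p)"
    if "smooth g" "smooth Y" for g and X Y :: "'n vfield"
    unfolding flat_connection_def vf_deriv_def
      frechet_derivative_at[OF has_derivative_scaleR[OF D[OF that(1)] D[OF that(2)]], symmetric]
    by (simp add: fun_eq_iff add.commute)
  show "(\<lambda>p. flat_connection X Y p - flat_connection Y X p) = lie_bracket X Y" for X Y :: "'n vfield"
    by (rule ext) (simp add: flat_connection_def lie_bracket_def)
qed (rule smooth_flat_connection)

text \<open>The geodesic equation reads \<open>v' = 0\<close>, so \<open>v\<close> is constant, and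
  then so is \<open>\<gamma> t - t *\<^sub>R v 0\<close>.\<close>

lemma geodesic_flat_connection_affine:
  assumes "geodesic flat_connection \<gamma>"
  obtains w where "\<And>t. t \<in> {0..1} \<Longrightarrow> \<gamma> t = \<gamma> 0 + t *\<^sub>R w"
proof -
  obtain v where "\<forall>t\<in>{0..1}. (\<gamma> has_vector_derivative v t) (at t within {0..1}) \<and>
      (v has_vector_derivative 0) (at t within {0..1})"
    using assms unfolding geodesic_def by (auto simp: christoffel_def flat_connection_def)
  then have \<gamma>: "\<And>t. t \<in> {0..1} \<Longrightarrow> (\<gamma> has_vector_derivative v t) (at t within {0..1})"
    and v: "\<And>t. t \<in> {0..1} \<Longrightarrow> (v has_vector_derivative 0) (at t within {0..1})"
    by blast+
  obtain c where "\<And>t. t \<in> {0..1} \<Longrightarrow> v t = c"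
    using has_vector_derivative_zero_constant[OF convex_real_interval(5) v] by blast
  then have v_eq: "v t = v 0" if "t \<in> {0..1}" for t
    using that by simp
  have "((\<lambda>t. \<gamma> t - t *\<^sub>R v 0) has_vector_derivative 0) (at t within {0..1})"
    if "t \<in> {0..1}" for t
    using has_vector_derivative_diff[OF \<gamma>[OF that]
        has_vector_derivative_scaleR[OF DERIV_ident has_vector_derivative_const[of "v 0"]]]
      v_eq[OF that]
    by simp
  then obtain c where c: "\<And>t. t \<in> {0..1} \<Longrightarrow> \<gamma> t - t *\<^sub>R v 0 = c"
    using has_vector_derivative_zero_constant[OF convex_real_interval(5),
        of 0 1 "\<lambda>t. \<gamma> t - t *\<^sub>R v 0"] by blast
  have "\<gamma> t = \<gamma> 0 + t *\<^sub>R v 0" if "t \<in> {0..1}" for t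
    using c[OF that] c[of 0] by (simp add: diff_eq_eq)
  then show thesis by (rule that)
qed

lemma convex_imp_g_convex_flat_connection:
  assumes "smooth f" "convex_on UNIV f"
  shows "g_convex flat_connection f"
  unfolding g_convex_def
proof (intro conjI allI impI assms(1))
  fix \<gamma> :: "real \<Rightarrow> real ^ 'a" assume "geodesic flat_connection \<gamma>"
  then obtain w where \<gamma>: "\<And>t. t \<in> {0..1} \<Longrightarrow> \<gamma> t = \<gamma> 0 + t *\<^sub>R w"
    by (rule geodesic_flat_connection_affine) (rule that)
  show "convex_on {0..1} (f \<circ> \<gamma>)"
  proof (rule convex_onI)
    fix t x y :: real assume t: "0 < t" "t < 1" and xy: "x \<in> {0..1}" "y \<in> {0..1}"
    \<comment> \<open>The curve is known to be affine only on the unit interval, so the intermediate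
      time has to be placed there first.\<close>
    have "(1 - t) *\<^sub>R x + t *\<^sub>R y \<in> {0..1}"
      using convexD[OF convex_real_interval(5) xy, of "1 - t" t] t by simp
    then have "\<gamma> ((1 - t) *\<^sub>R x + t *\<^sub>R y) = (1 - t) *\<^sub>R \<gamma> x + t *\<^sub>R \<gamma> y"
      unfolding \<gamma>[OF xy(1)] \<gamma>[OF xy(2)] by (subst \<gamma>) (simp_all add: algebra_simps)
    then show "(f \<circ> \<gamma>) ((1 - t) *\<^sub>R x + t *\<^sub>R y) \<le> (1 - t) * (f \<circ> \<gamma>) x + t * (f \<circ> \<gamma>) y"
      using convex_onD[OF assms(2), of t "\<gamma> x" "\<gamma> y"] t by simp
  qed simp
qed

subsection \<open>Geodesics near the origin\<close>

lemma norm_integral_unit_le: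
  fixes f :: "real \<Rightarrow> 'a::banach"
  assumes "continuous_on {0..1} f" "\<And>s. s \<in> {0..1} \<Longrightarrow> norm (f s) \<le> B" "t \<in> {0..1}"
  shows "norm (integral {0..t} f) \<le> B"
proof -
  have "B \<ge> 0" using order_trans[OF norm_ge_zero assms(2)[of 0]] by simp
  have "norm (integral {0..t} f) \<le> B * (t - 0)"
    using assms by (intro integral_bound) (auto intro: continuous_on_subset)
  also have "\<dots> \<le> B" using assms(3) \<open>B \<ge> 0\<close> by (simp add: mult_left_le)
  finally show ?thesis .
qed

text \<open>Contraction argument with the acceleration as the unknown: velocity and position are its iterated
  integrals over \<open>[0,1]\<close>, so both depend on it with Lipschitz constant \<open>1\<close>.\<close>

lemma second_order_ode_near_line:
  fixes G :: "'a::banach \<Rightarrow> 'a \<Rightarrow> 'a"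
  assumes R: "norm x + norm w + 1 \<le> R" and M: "0 \<le> M" "M \<le> 1" and c: "0 \<le> c" "2 * c < 1"
    and bound: "\<And>u v. norm u \<le> R \<Longrightarrow> norm v \<le> R \<Longrightarrow> norm (G u v) \<le> M"
    and lip: "\<And>u v u' v'. norm u \<le> R \<Longrightarrow> norm v \<le> R \<Longrightarrow> norm u' \<le> R \<Longrightarrow> norm v' \<le> R \<Longrightarrow>
      norm (G u v - G u' v') \<le> c * (norm (u - u') + norm (v - v'))"
  shows "\<exists>u v. u 0 = x \<and> (\<forall>t\<in>{0..1}.
     (u has_vector_derivative v t) (at t within {0..1}) \<and>
     (v has_vector_derivative G (u t) (v t)) (at t within {0..1}) \<and>
     norm (u t - (x + t *\<^sub>R w)) \<le> M)"
proof -
  \<comment> \<open>\<open>V \<alpha>\<close> and \<open>U \<alpha>\<close> are the velocity and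
    position of the curve with acceleration \<alpha> that starts at \<open>x\<close> with velocity
    \<open>w\<close>.\<close>
  define V where "V \<alpha> = (\<lambda>t. w + integral {0..t} \<alpha>)" for \<alpha> :: "real \<Rightarrow> 'a"
  define U where "U \<alpha> = (\<lambda>t. x + integral {0..t} (V \<alpha>))" for \<alpha> :: "real \<Rightarrow> 'a"
  have contV: "continuous_on {0..1} (V \<alpha>)" if "continuous_on {0..1} \<alpha>" for \<alpha>
    unfolding V_def using that
    by (intro continuous_intros indefinite_integral_continuous_1 integrable_continuous_real)
  have contU: "continuous_on {0..1} (U \<alpha>)" if "continuous_on {0..1} \<alpha>" for \<alpha>
    unfolding U_def using contV[OF that]
    by (intro continuous_intros indefinite_integral_continuous_1 integrable_continuous_real)
  have int: "f integrable_on {0..t}" if "continuous_on {0..1} f" "t \<in> {0..1}" for f :: "real \<Rightarrow> 'a" and t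
    using that by (intro integrable_continuous_real) (auto intro: continuous_on_subset)
  have V_near: "norm (V \<alpha> t - w) \<le> M"
    if "continuous_on {0..1} \<alpha>" "\<And>s. s \<in> {0..1} \<Longrightarrow> norm (\<alpha> s) \<le> M" "t \<in> {0..1}" for \<alpha> t
    using norm_integral_unit_le[OF that] by (simp add: V_def)
  have U_near: "norm (U \<alpha> t - (x + t *\<^sub>R w)) \<le> M"
    if \<alpha>: "continuous_on {0..1} \<alpha>" "\<And>s. s \<in> {0..1} \<Longrightarrow> norm (\<alpha> s) \<le> M" and t: "t \<in> {0..1}" for \<alpha> t
  proof -
    have "U \<alpha> t - (x + t *\<^sub>R w) = integral {0..t} (\<lambda>s. V \<alpha> s - w)"
      using t integral_diff[OF int[OF contV[OF \<alpha>(1)] t] integrable_const_ivl, of w]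
      by (simp add: U_def)
    then show ?thesis
      using norm_integral_unit_le[of "\<lambda>s. V \<alpha> s - w" M t] V_near[OF \<alpha>] t
        continuous_on_diff[OF contV[OF \<alpha>(1)] continuous_on_const]
      by simp
  qed
  \<comment> \<open>This is where \<open>R\<close> comes from: positions and velocities stray at
    most \<open>M \<le> 1\<close> from the line and from \<open>w\<close>, so they stay in the ball
    on which \<open>bound\<close> and \<open>lip\<close> apply.\<close>
  have V_bd: "norm (V \<alpha> t) \<le> R" and U_bd: "norm (U \<alpha> t) \<le> R"
    if \<alpha>: "continuous_on {0..1} \<alpha>" "\<And>s. s \<in> {0..1} \<Longrightarrow> norm (\<alpha> s) \<le> M" and t: "t \<in> {0..1}" for \<alpha> t
  proof -
    have "norm (V \<alpha> t) \<le> norm (V \<alpha> t - w) + norm w"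
      by (metis diff_add_cancel norm_triangle_ineq)
    then show "norm (V \<alpha> t) \<le> R" using V_near[OF that] M R norm_ge_zero[of x] by linarith
    have "norm (U \<alpha> t) \<le> norm (U \<alpha> t - (x + t *\<^sub>R w)) + norm (x + t *\<^sub>R w)"
      by (metis diff_add_cancel norm_triangle_ineq)
    also have "norm (x + t *\<^sub>R w) \<le> norm x + norm w"
      by (rule norm_triangle_le) (use t in \<open>auto simp: mult_left_le_one_le\<close>)
    finally show "norm (U \<alpha> t) \<le> R" using U_near[OF that] M R by linarith
  qed
  have V_diff: "norm (V \<alpha> t - V \<beta> t) \<le> D"
    if "continuous_on {0..1} \<alpha>" "continuous_on {0..1} \<beta>" "t \<in> {0..1}"
      "\<And>s. s \<in> {0..1} \<Longrightarrow> norm (\<alpha> s - \<beta> s) \<le> D" for \<alpha> \<beta> t D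
  proof -
    have "V \<alpha> t - V \<beta> t = integral {0..t} (\<lambda>s. \<alpha> s - \<beta> s)"
      using that by (simp add: V_def integral_diff int)
    then show ?thesis
      using norm_integral_unit_le[OF continuous_on_diff[OF that(1,2)] that(4,3)] by simp
  qed
  have U_diff: "norm (U \<alpha> t - U \<beta> t) \<le> D"
    if "continuous_on {0..1} \<alpha>" "continuous_on {0..1} \<beta>" "t \<in> {0..1}"
      "\<And>s. s \<in> {0..1} \<Longrightarrow> norm (\<alpha> s - \<beta> s) \<le> D" for \<alpha> \<beta> t D
  proof -
    have "U \<alpha> t - U \<beta> t = integral {0..t} (\<lambda>s. V \<alpha> s - V \<beta> s)"
      using that by (simp add: U_def integral_diff int contV)
    then show ?thesis
      using norm_integral_unit_le[OF continuous_on_diff[OF contV[OF that(1)] contV[OF that(2)]]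
          V_diff[OF that(1,2) _ that(4)] that(3)]
      by simp
  qed
  define acc where "acc \<alpha> = (\<lambda>t. G (U \<alpha> t) (V \<alpha> t))" for \<alpha>
  \<comment> \<open>The space of bounded continuous functions on the whole line is complete in the
    supremum norm. Clamping the time to the unit interval extends the acceleration to such a
    function.\<close>
  define P :: "(real \<Rightarrow>\<^sub>C 'a) \<Rightarrow> real \<Rightarrow>\<^sub>C 'a"
    where "P \<alpha> = Bcontfun (\<lambda>t. acc \<alpha> (max 0 (min 1 t)))" for \<alpha>
  define S where "S = (cball 0 M :: (real \<Rightarrow>\<^sub>C 'a) set)"
  have S_bd: "norm (\<alpha> s) \<le> M" if "\<alpha> \<in> S" for \<alpha> :: "real \<Rightarrow>\<^sub>C 'a" and s
    using norm_bounded[of \<alpha> s] that by (simp add: S_def)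
  \<comment> \<open>Continuity of the acceleration follows from \<open>lip\<close>: its increments
    are dominated by those of \<open>U \<alpha>\<close> and \<open>V \<alpha>\<close>, which tend to
    0.\<close>
  have cont_acc: "continuous_on {0..1} (acc \<alpha>)" if "\<alpha> \<in> S" for \<alpha> :: "real \<Rightarrow>\<^sub>C 'a"
    unfolding continuous_on_def
  proof
    fix t :: real assume t: "t \<in> {0..1}"
    have cont: "continuous_on {0..1} \<alpha>" by simp
    have "((\<lambda>s. c * (norm (U \<alpha> s - U \<alpha> t) + norm (V \<alpha> s - V \<alpha> t))) \<longlongrightarrow>
        c * (norm (U \<alpha> t - U \<alpha> t) + norm (V \<alpha> t - V \<alpha> t))) (at t within {0..1})"
      using contU[OF cont] contV[OF cont] t
      by (intro tendsto_intros) (auto simp: continuous_on_def)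
    then have lim: "((\<lambda>s. c * (norm (U \<alpha> s - U \<alpha> t) + norm (V \<alpha> s - V \<alpha> t))) \<longlongrightarrow> 0)
        (at t within {0..1})"
      by simp
    have "\<forall>\<^sub>F s in at t within {0..1}.
        norm (acc \<alpha> s - acc \<alpha> t) \<le> c * (norm (U \<alpha> s - U \<alpha> t) + norm (V \<alpha> s - V \<alpha> t))"
      unfolding acc_def eventually_at_filter
      by (intro always_eventually allI impI lip U_bd V_bd cont S_bd[OF that] t) auto
    from Lim_null_comparison[OF this lim]
    show "(acc \<alpha> \<longlongrightarrow> acc \<alpha> t) (at t within {0..1})" by (simp add: LIM_zero_iff)
  qed
  have acc_bd: "norm (acc \<alpha> t) \<le> M" if "\<alpha> \<in> S" "t \<in> {0..1}" for \<alpha> :: "real \<Rightarrow>\<^sub>C 'a" and t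
    unfolding acc_def by (intro bound U_bd V_bd S_bd[OF that(1)] that(2)) auto
  have P_apply: "P \<alpha> t = acc \<alpha> (max 0 (min 1 t))" if "\<alpha> \<in> S" for \<alpha> t
  proof -
    have "continuous_on UNIV (\<lambda>t. acc \<alpha> (max 0 (min 1 t)))"
      by (intro continuous_on_compose2[OF cont_acc[OF that]] continuous_intros) auto
    then have "(\<lambda>t. acc \<alpha> (max 0 (min 1 t))) \<in> bcontfun"
      by (rule bcontfun_normI[where b = M]) (intro acc_bd that; auto)
    then show ?thesis by (simp add: P_def Bcontfun_inverse)
  qed
  have "\<exists>!\<alpha>\<in>S. P \<alpha> = \<alpha>"
  \<comment> \<open>The factor is \<open>2 * c\<close> because \<open>lip\<close> contributes
    \<open>c\<close> times the sum of the position and velocity differences, each at most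
    \<open>dist \<alpha> \<beta>\<close>.\<close>
  proof (rule Banach_fix[of S "2 * c"])
    show "complete S" by (simp add: S_def complete_eq_closed)
    show "S \<noteq> {}" using M by (auto simp: S_def)
    have "norm (P \<alpha>) \<le> M" if "\<alpha> \<in> S" for \<alpha>
      using that by (intro norm_bound) (simp add: P_apply acc_bd)
    then show "P ` S \<subseteq> S" by (auto simp: S_def)
    show "dist (P \<alpha>) (P \<beta>) \<le> 2 * c * dist \<alpha> \<beta>" if "\<alpha> \<in> S" "\<beta> \<in> S" for \<alpha> \<beta>
    proof (rule dist_bound)
      fix t :: real
      define s where "s = max 0 (min 1 t)"
      have s: "s \<in> {0..1}" by (auto simp: s_def)
      have "norm (acc \<alpha> s - acc \<beta> s) \<le> c * (norm (U \<alpha> s - U \<beta> s) + norm (V \<alpha> s - V \<beta> s))"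
        unfolding acc_def by (intro lip U_bd V_bd S_bd that s) auto
      also have "\<dots> \<le> c * (dist \<alpha> \<beta> + dist \<alpha> \<beta>)"
        by (intro mult_left_mono add_mono U_diff V_diff c s)
          (auto simp: dist_norm[symmetric] intro: dist_bounded)
      finally show "dist (P \<alpha> t) (P \<beta> t) \<le> 2 * c * dist \<alpha> \<beta>"
        by (simp add: P_apply that dist_norm[of "acc \<alpha> s"] flip: s_def)
    qed
  qed (use c in auto)
  then obtain \<alpha> where \<alpha>: "\<alpha> \<in> S" "P \<alpha> = \<alpha>" by blast
  \<comment> \<open>Clamping is the identity on the unit interval, so there the fixed point solves
    the original equation.\<close>
  have \<alpha>_eq: "\<alpha> t = G (U \<alpha> t) (V \<alpha> t)" if "t \<in> {0..1}" for t
    using P_apply[OF \<alpha>(1), of t] \<alpha>(2) that by (simp add: acc_def)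
  have cont: "continuous_on {0..1} \<alpha>" by simp
  show ?thesis
  proof (intro exI conjI ballI)
    fix t :: real assume t: "t \<in> {0..1}"
    show "(U \<alpha> has_vector_derivative V \<alpha> t) (at t within {0..1})"
      unfolding U_def
      by (auto intro!: derivative_eq_intros integral_has_vector_derivative[OF contV[OF cont] t])
    have "(V \<alpha> has_vector_derivative \<alpha> t) (at t within {0..1})"
      unfolding V_def
      by (auto intro!: derivative_eq_intros integral_has_vector_derivative[OF cont t])
    then show "(V \<alpha> has_vector_derivative G (U \<alpha> t) (V \<alpha> t)) (at t within {0..1})"
      using \<alpha>_eq[OF t] by simp
    show "norm (U \<alpha> t - (x + t *\<^sub>R w)) \<le> M"
      by (intro U_near cont S_bd[OF \<alpha>(1)] t)
  qed (simp add: U_def)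
qed

section \<open>Lipschitz estimates for the geodesic equation\<close>

text \<open>The derivatives in the basis directions are bounded on the compact ball; their bounds
  add up to one for the operator norm, and the mean value inequality applies on the convex
  ball.\<close>

lemma C1_lipschitz_on_cball:
  fixes f :: "'a::euclidean_space \<Rightarrow> 'b::real_normed_vector"
  assumes "Ck (Suc 0) f"
  obtains L where "L \<ge> 0" "\<And>x y. norm x \<le> R \<Longrightarrow> norm y \<le> R \<Longrightarrow> norm (f x - f y) \<le> L * norm (x - y)"
proof -
  note D = Ck_SucD[OF assms]
  have "\<exists>B. \<forall>x\<in>cball 0 R. norm (frechet_derivative f (at x) b) \<le> B" for b
  proof -
    have "continuous_on (cball 0 R) (\<lambda>x. frechet_derivative f (at x) b)"
      using D(2)[of b] continuous_on_subset[OF _ subset_UNIV] by simp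
    from compact_imp_bounded[OF compact_continuous_image[OF this compact_cball]]
    show ?thesis unfolding bounded_iff by blast
  qed
  then obtain B where B: "\<And>b x. norm x \<le> R \<Longrightarrow> norm (frechet_derivative f (at x) b) \<le> B b"
    by (metis mem_cball_0)
  \<comment> \<open>For negative \<open>R\<close> the ball is empty and the numbers
    \<open>B b\<close> are arbitrary, hence the maximum with 0.\<close>
  define L where "L = max 0 (\<Sum>b\<in>Basis. B b)"
  have "onorm (frechet_derivative f (at x)) \<le> L" if x: "x \<in> cball 0 R" for x
  proof (rule onorm_le)
    fix h :: 'a
    interpret bounded_linear "frechet_derivative f (at x)"
      using D(1) has_derivative_bounded_linear by blast
    have "frechet_derivative f (at x) h = frechet_derivative f (at x) (\<Sum>b\<in>Basis. (h \<bullet> b) *\<^sub>R b)"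
      by (simp add: euclidean_representation)
    also have "\<dots> = (\<Sum>b\<in>Basis. (h \<bullet> b) *\<^sub>R frechet_derivative f (at x) b)"
      by (simp add: sum scaleR)
    also have "norm \<dots> \<le> (\<Sum>b\<in>Basis. norm h * B b)"
      using x by (intro sum_norm_le) (auto intro!: mult_mono B Basis_le_norm)
    also have "\<dots> \<le> L * norm h"
      by (simp add: L_def mult.commute[of _ "norm h"] mult_left_mono flip: sum_distrib_left)
    finally show "norm (frechet_derivative f (at x) h) \<le> L * norm h" .
  qed
  then have lip: "norm (f x - f y) \<le> L * norm (x - y)" if "norm x \<le> R" "norm y \<le> R" for x y
    using differentiable_bound[OF convex_cball has_derivative_at_withinI[OF D(1)], of 0 R] that
    by simp
  have "L \<ge> 0" by (simp add: L_def)
  then show thesis using that lip by blast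
qed

text \<open>On a ball each summand is a product of bounded Lipschitz functions, namely two velocity
  components and a coefficient, and such a product is again Lipschitz.\<close>

lemma quadratic_form_lipschitz:
  fixes \<Gamma> :: "'a::euclidean_space \<Rightarrow> 'n::finite \<Rightarrow> 'n \<Rightarrow> 'b::real_normed_vector"
  assumes "\<And>i j. Ck (Suc 0) (\<lambda>p. \<Gamma> p i j)" and "R \<ge> 0"
  obtains K where "K \<ge> 0"
    "\<And>p (v :: real ^ 'n) p' v'. norm p \<le> R \<Longrightarrow> norm v \<le> R \<Longrightarrow> norm p' \<le> R \<Longrightarrow>
      norm v' \<le> R \<Longrightarrow> norm ((\<Sum>i\<in>UNIV. \<Sum>j\<in>UNIV. (v $ i * v $ j) *\<^sub>R \<Gamma> p i j) -
        (\<Sum>i\<in>UNIV. \<Sum>j\<in>UNIV. (v' $ i * v' $ j) *\<^sub>R \<Gamma> p' i j))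
      \<le> K * (norm (p - p') + norm (v - v'))"
proof -
  have "\<exists>L\<ge>0. \<forall>p p'. norm p \<le> R \<longrightarrow> norm p' \<le> R \<longrightarrow>
      norm (\<Gamma> p i j - \<Gamma> p' i j) \<le> L * norm (p - p')" for i j
    by (rule C1_lipschitz_on_cball[OF assms(1), of R i j]) blast
  then obtain L where L0: "\<And>i j. L i j \<ge> 0" and L: "\<And>i j p p'. norm p \<le> R \<Longrightarrow> norm p' \<le> R \<Longrightarrow>
      norm (\<Gamma> p i j - \<Gamma> p' i j) \<le> L i j * norm (p - p')"
    by metis
  define B where "B i j = norm (\<Gamma> 0 i j) + L i j * R" for i j
  have B0: "B i j \<ge> 0" for i j using L0 assms(2) by (simp add: B_def)
  have B: "norm (\<Gamma> p i j) \<le> B i j" if "norm p \<le> R" for p i j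
  proof -
    have "norm (\<Gamma> p i j) \<le> norm (\<Gamma> 0 i j) + norm (\<Gamma> p i j - \<Gamma> 0 i j)"
      by (rule norm_triangle_sub)
    also have "norm (\<Gamma> p i j - \<Gamma> 0 i j) \<le> L i j * norm (p - 0)"
      using that assms(2) by (intro L) auto
    also have "\<dots> \<le> L i j * R" using that L0 by (auto intro: mult_left_mono)
    finally show ?thesis by (simp add: B_def)
  qed
  \<comment> \<open>The term \<open>R * R * L i j\<close> pays for changing the coefficient, and
    \<open>2 * R * B i j\<close> for changing the two velocity factors one at a time.\<close>
  define k where "k i j = R * R * L i j + 2 * R * B i j" for i j
  have k0: "k i j \<ge> 0" for i j using L0 B0 assms(2) by (simp add: k_def)
  show thesis
  proof (rule that[of "\<Sum>i\<in>UNIV. \<Sum>j\<in>UNIV. k i j"])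
    fix p p' :: 'a and v v' :: "real ^ 'n"
    assume *: "norm p \<le> R" "norm v \<le> R" "norm p' \<le> R" "norm v' \<le> R"
    have v: "\<bar>v $ i\<bar> \<le> R" "\<bar>v' $ i\<bar> \<le> R" "\<bar>v $ i - v' $ i\<bar> \<le> norm (v - v')" for i
      using * component_le_norm_cart[of v i] component_le_norm_cart[of v' i]
        component_le_norm_cart[of "v - v'" i] by auto
    have summand: "norm ((v $ i * v $ j) *\<^sub>R \<Gamma> p i j - (v' $ i * v' $ j) *\<^sub>R \<Gamma> p' i j)
        \<le> k i j * (norm (p - p') + norm (v - v'))" for i j
    proof -
      have "(v $ i * v $ j) *\<^sub>R \<Gamma> p i j - (v' $ i * v' $ j) *\<^sub>R \<Gamma> p' i j =
          (v $ i * v $ j) *\<^sub>R (\<Gamma> p i j - \<Gamma> p' i j) +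
          (v $ i * (v $ j - v' $ j) + (v $ i - v' $ i) * v' $ j) *\<^sub>R \<Gamma> p' i j"
        by (simp add: algebra_simps)
      also have "norm \<dots> \<le> \<bar>v $ i\<bar> * \<bar>v $ j\<bar> * norm (\<Gamma> p i j - \<Gamma> p' i j) +
          (\<bar>v $ i\<bar> * \<bar>v $ j - v' $ j\<bar> + \<bar>v $ i - v' $ i\<bar> * \<bar>v' $ j\<bar>) * norm (\<Gamma> p' i j)"
        by (intro norm_triangle_le add_mono)
          (auto simp: abs_mult intro!: mult_right_mono abs_triangle_ineq[THEN order_trans])
      also have "\<dots> \<le> R * R * (L i j * norm (p - p')) +
          (R * norm (v - v') + norm (v - v') * R) * B i j"
        using * v assms(2) by (intro add_mono mult_mono L B) auto
      also have "\<dots> \<le> k i j * (norm (p - p') + norm (v - v'))"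
        using L0[of i j] B0[of i j] assms(2) by (simp add: k_def algebra_simps)
      finally show ?thesis .
    qed
    show "norm ((\<Sum>i\<in>UNIV. \<Sum>j\<in>UNIV. (v $ i * v $ j) *\<^sub>R \<Gamma> p i j) -
        (\<Sum>i\<in>UNIV. \<Sum>j\<in>UNIV. (v' $ i * v' $ j) *\<^sub>R \<Gamma> p' i j))
      \<le> (\<Sum>i\<in>UNIV. \<Sum>j\<in>UNIV. k i j) * (norm (p - p') + norm (v - v'))"
      unfolding sum_subtractf[symmetric] sum_distrib_right by (intro sum_norm_le summand)
  qed (simp add: sum_nonneg k0)
qed

section \<open>Convexity along rescaled geodesics\<close>

text \<open>The rescaled equation has right-hand side \<open>G u v\<close>, whose size and Lipschitz
  constant on the ball are at most \<open>\<epsilon> * C\<close> and \<open>\<epsilon> * K\<close>.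
  For small \<epsilon> this meets the hypotheses of \<open>second_order_ode_near_line\<close>. The
  constants depend on \<open>x\<close>, \<open>w\<close> and \<open>nabla\<close> but not on
  \<epsilon>.\<close>

lemma geodesics_near_lines:
  fixes x w :: "real ^ 'n"
  assumes "affine_connection nabla"
  obtains C \<epsilon>0 where "\<epsilon>0 > 0"
    "\<And>\<epsilon>. 0 < \<epsilon> \<Longrightarrow> \<epsilon> \<le> \<epsilon>0 \<Longrightarrow> \<exists>u. geodesic nabla (\<lambda>t. \<epsilon> *\<^sub>R u t) \<and> u 0 = x \<and>
      (\<forall>t\<in>{0..1}. norm (u t - (x + t *\<^sub>R w)) \<le> \<epsilon> * C)"
proof -
  define R where "R = norm x + norm w + 1"
  have R: "R \<ge> 1" by (simp add: R_def)
  define Q where "Q p v = (\<Sum>i\<in>UNIV. \<Sum>j\<in>UNIV. (v $ i * v $ j) *\<^sub>R christoffel nabla p i j)"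
    for p v :: "real ^ 'n"
  have "smooth (\<lambda>p. christoffel nabla p i j)" for i j
    unfolding christoffel_def
    by (intro affine_connection.smooth_nabla[OF assms]) (auto simp: smooth_def intro: Ck_const)
  then have "Ck (Suc 0) (\<lambda>p. christoffel nabla p i j)" for i j
    unfolding smooth_def by blast
  then obtain K where K0: "K \<ge> 0" and K': "\<And>p (v :: real ^ 'n) p' v'. norm p \<le> R \<Longrightarrow> norm v \<le> R \<Longrightarrow>
      norm p' \<le> R \<Longrightarrow> norm v' \<le> R \<Longrightarrow>
      norm ((\<Sum>i\<in>UNIV. \<Sum>j\<in>UNIV. (v $ i * v $ j) *\<^sub>R christoffel nabla p i j) -
        (\<Sum>i\<in>UNIV. \<Sum>j\<in>UNIV. (v' $ i * v' $ j) *\<^sub>R christoffel nabla p' i j))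
      \<le> K * (norm (p - p') + norm (v - v'))"
    by (rule quadratic_form_lipschitz[where R = R and \<Gamma> = "christoffel nabla"]) (use R in auto)
  note K = K'[folded Q_def]
  \<comment> \<open>Since \<open>Q 0 0 = 0\<close>, comparison with the origin bounds
    \<open>Q\<close> by \<open>K * (R + R)\<close> on the ball.\<close>
  define C where "C = 2 * K * R"
  have C0: "C \<ge> 0" and KC: "2 * K \<le> C"
    using K0 R mult_left_mono[OF R K0] by (auto simp: C_def)
  show thesis
  \<comment> \<open>This choice gives \<open>\<epsilon> * C < 1\<close>, hence a contraction because
    \<open>2 * K \<le> C\<close>. It also gives \<open>\<epsilon> \<le> 1\<close>, so that scaling
    by \<epsilon> stays inside the ball.\<close>
  proof (rule that[of "1 / (C + 1)" C])
    show "1 / (C + 1) > 0" using C0 by simp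
    fix \<epsilon> :: real assume \<epsilon>: "0 < \<epsilon>" "\<epsilon> \<le> 1 / (C + 1)"
    have "\<epsilon> * (C + 1) \<le> 1" using \<epsilon> C0 by (simp add: field_simps)
    then have "\<epsilon> * C + \<epsilon> \<le> 1" by (simp add: algebra_simps)
    moreover have "0 \<le> \<epsilon> * C" using \<epsilon> C0 by simp
    ultimately have \<epsilon>C: "\<epsilon> * C < 1" and "\<epsilon> \<le> 1" using \<epsilon> by linarith+
    have scale: "norm (\<epsilon> *\<^sub>R u) \<le> R" if "norm u \<le> R" for u :: "real ^ 'n"
      using mult_mono[OF \<open>\<epsilon> \<le> 1\<close> that] \<epsilon> R by simp
    define G where "G u v = - (\<epsilon> *\<^sub>R Q (\<epsilon> *\<^sub>R u) v)" for u v
    have "\<exists>u v. u 0 = x \<and> (\<forall>t\<in>{0..1}.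
       (u has_vector_derivative v t) (at t within {0..1}) \<and>
       (v has_vector_derivative G (u t) (v t)) (at t within {0..1}) \<and>
       norm (u t - (x + t *\<^sub>R w)) \<le> \<epsilon> * C)"
    proof (rule second_order_ode_near_line[where R = R and c = "\<epsilon> * K"])
      show "2 * (\<epsilon> * K) < 1"
        using \<epsilon>C mult_left_mono[OF KC less_imp_le[OF \<epsilon>(1)]] by (simp add: mult.left_commute)
      show "norm (G u v) \<le> \<epsilon> * C" if "norm u \<le> R" "norm v \<le> R" for u v
      proof -
        have "norm (Q (\<epsilon> *\<^sub>R u) v - Q 0 0) \<le> K * (norm (\<epsilon> *\<^sub>R u - 0) + norm (v - 0))"
          using that R by (intro K scale) auto
        also have "\<dots> \<le> K * (R + R)"
          using scale[OF that(1)] that(2) K0 by (intro mult_left_mono add_mono) auto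
        finally have "norm (Q (\<epsilon> *\<^sub>R u) v) \<le> C" by (simp add: Q_def C_def)
        then show ?thesis using \<epsilon> by (simp add: G_def mult_left_mono)
      qed
      show "norm (G u v - G u' v') \<le> \<epsilon> * K * (norm (u - u') + norm (v - v'))"
        if "norm u \<le> R" "norm v \<le> R" "norm u' \<le> R" "norm v' \<le> R" for u v u' v'
      proof -
        have "norm (G u v - G u' v') = \<epsilon> * norm (Q (\<epsilon> *\<^sub>R u) v - Q (\<epsilon> *\<^sub>R u') v')"
          using \<epsilon> by (simp add: G_def norm_minus_commute flip: scaleR_diff_right)
        also have "\<dots> \<le> \<epsilon> * (K * (norm (\<epsilon> *\<^sub>R u - \<epsilon> *\<^sub>R u') + norm (v - v')))"
          using \<epsilon> that by (intro mult_left_mono K scale) auto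
        also have "\<dots> \<le> \<epsilon> * (K * (norm (u - u') + norm (v - v')))"
          using \<epsilon> \<open>\<epsilon> \<le> 1\<close> K0
          by (intro mult_left_mono add_mono)
            (auto simp: mult_left_le_one_le simp flip: scaleR_diff_right)
        finally show ?thesis by (simp add: mult.assoc)
      qed
    qed (use \<epsilon> \<epsilon>C C0 K0 in \<open>auto simp: R_def\<close>)
    then obtain u v where u0: "u 0 = x"
      and u: "\<And>t. t \<in> {0..1} \<Longrightarrow> (u has_vector_derivative v t) (at t within {0..1})"
      and v: "\<And>t. t \<in> {0..1} \<Longrightarrow> (v has_vector_derivative G (u t) (v t)) (at t within {0..1})"
      and near: "\<And>t. t \<in> {0..1} \<Longrightarrow> norm (u t - (x + t *\<^sub>R w)) \<le> \<epsilon> * C"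
      by blast
    \<comment> \<open>\<open>Q\<close> is quadratic in the velocity: of the two factors \<epsilon>,
      one is carried by \<open>G\<close> and the other comes from differentiating the rescaled
      curve.\<close>
    have Q_scale: "Q p (\<epsilon> *\<^sub>R v) = (\<epsilon> * \<epsilon>) *\<^sub>R Q p v" for p v
      by (simp add: Q_def scaleR_sum_right algebra_simps)
    have "geodesic nabla (\<lambda>t. \<epsilon> *\<^sub>R u t)"
      unfolding geodesic_def
    proof (intro exI ballI conjI)
      fix t :: real assume t: "t \<in> {0..1}"
      show "((\<lambda>t. \<epsilon> *\<^sub>R u t) has_vector_derivative \<epsilon> *\<^sub>R v t) (at t within {0..1})"
        using bounded_linear.has_vector_derivative[OF bounded_linear_scaleR_right u[OF t]] .
      have "((\<lambda>t. \<epsilon> *\<^sub>R v t) has_vector_derivative \<epsilon> *\<^sub>R G (u t) (v t)) (at t within {0..1})"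
        using bounded_linear.has_vector_derivative[OF bounded_linear_scaleR_right v[OF t]] .
      moreover have "\<epsilon> *\<^sub>R G (u t) (v t) = - Q (\<epsilon> *\<^sub>R u t) (\<epsilon> *\<^sub>R v t)"
        by (simp add: G_def Q_scale)
      ultimately show "((\<lambda>t. \<epsilon> *\<^sub>R v t) has_vector_derivative
          - (\<Sum>i\<in>UNIV. \<Sum>j\<in>UNIV. ((\<epsilon> *\<^sub>R v t) $ i * (\<epsilon> *\<^sub>R v t) $ j) *\<^sub>R
            christoffel nabla (\<epsilon> *\<^sub>R u t) i j)) (at t within {0..1})"
        by (simp only: Q_def)
    qed
    with u0 near show "\<exists>u. geodesic nabla (\<lambda>t. \<epsilon> *\<^sub>R u t) \<and> u 0 = x \<and>
        (\<forall>t\<in>{0..1}. norm (u t - (x + t *\<^sub>R w)) \<le> \<epsilon> * C)" by blast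
  qed
qed

text \<open>Homogeneity turns convexity along the geodesic \<open>\<epsilon> u\<close> into
  convexity along \<open>u\<close>, as the positive factor \<open>\<epsilon> ^ D\<close> cancels.
  Continuity of \<open>f\<close> then carries the inequality to the limiting segment from
  \<open>x\<close> to \<open>y\<close>.\<close>

lemma g_convex_homogeneous_imp_convex:
  fixes f :: "real ^ 'n \<Rightarrow> real"
  assumes "affine_connection nabla" "g_convex nabla f"
    and hom: "\<And>c x. c > 0 \<Longrightarrow> f (c *\<^sub>R x) = c ^ D * f x"
  shows "convex_on UNIV f"
proof (rule convex_onI)
  fix t :: real and x y :: "real ^ 'n" assume t: "0 < t" "t < 1"
  have "Ck 0 f" using assms(2) by (simp only: g_convex_def smooth_def)
  then have cont: "isCont f z" for z by (simp add: continuous_on_eq_continuous_at)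
  obtain C \<epsilon>0 where \<epsilon>0: "\<epsilon>0 > 0" and ex: "\<And>\<epsilon>. 0 < \<epsilon> \<Longrightarrow> \<epsilon> \<le> \<epsilon>0 \<Longrightarrow>
      \<exists>u. geodesic nabla (\<lambda>t. \<epsilon> *\<^sub>R u t) \<and> u 0 = x \<and>
      (\<forall>t\<in>{0..1}. norm (u t - (x + t *\<^sub>R (y - x))) \<le> \<epsilon> * C)"
    using geodesics_near_lines[OF assms(1)] by metis
  define \<epsilon> where "\<epsilon> n = \<epsilon>0 / real (Suc n)" for n
  have \<epsilon>: "0 < \<epsilon> n" "\<epsilon> n \<le> \<epsilon>0" for n using \<epsilon>0 by (auto simp: \<epsilon>_def field_simps)
  obtain u where geo: "\<And>n. geodesic nabla (\<lambda>t. \<epsilon> n *\<^sub>R u n t)" and u0: "\<And>n. u n 0 = x"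
    and near: "\<And>n t. t \<in> {0..1} \<Longrightarrow> norm (u n t - (x + t *\<^sub>R (y - x))) \<le> \<epsilon> n * C"
    using ex[OF \<epsilon>] by metis
  have "(\<lambda>n. \<epsilon> n * C) \<longlonglongrightarrow> 0"
    unfolding \<epsilon>_def using tendsto_mult_left_zero[OF LIMSEQ_Suc[OF lim_const_over_n]] .
  then have lim: "(\<lambda>n. u n s) \<longlonglongrightarrow> x + s *\<^sub>R (y - x)" if "s \<in> {0..1}" for s
    using Lim_null_comparison[OF always_eventually, OF allI, OF near[OF that]]
    by (simp add: LIM_zero_iff)
  \<comment> \<open>Convexity is used between the times 0 and 1. Every \<open>u n\<close> starts
    exactly at \<open>x\<close>, so only the values at \<open>t\<close> and 1 need a limit.\<close>
  have le: "f (u n t) \<le> (1 - t) * f x + t * f (u n 1)" for n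
  proof -
    have "convex_on {0..1} (f \<circ> (\<lambda>t. \<epsilon> n *\<^sub>R u n t))"
      using assms(2) geo by (auto simp: g_convex_def)
    from convex_onD[OF this, of t 0 1]
    have "\<epsilon> n ^ D * f (u n t) \<le> \<epsilon> n ^ D * ((1 - t) * f x + t * f (u n 1))"
      using t by (simp add: hom \<epsilon> u0 algebra_simps)
    then show ?thesis using \<epsilon>[of n] by (simp add: mult_le_cancel_left)
  qed
  have f_lim: "(\<lambda>n. f (u n s)) \<longlonglongrightarrow> f (x + s *\<^sub>R (y - x))" if "s \<in> {0..1}" for s
    using isCont_tendsto_compose[OF cont lim[OF that]] .
  have "(\<lambda>n. (1 - t) * f x + t * f (u n 1)) \<longlonglongrightarrow> (1 - t) * f x + t * f (x + 1 *\<^sub>R (y - x))"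
    using tendsto_add[OF tendsto_const tendsto_mult_left[OF f_lim[of 1]]] by simp
  then have "f (x + t *\<^sub>R (y - x)) \<le> (1 - t) * f x + t * f (x + 1 *\<^sub>R (y - x))"
    using LIMSEQ_le[OF f_lim[of t]] le t by simp
  moreover have "x + t *\<^sub>R (y - x) = (1 - t) *\<^sub>R x + t *\<^sub>R y"
    by (simp add: scaleR_diff_left scaleR_diff_right)
  ultimately show "f ((1 - t) *\<^sub>R x + t *\<^sub>R y) \<le> (1 - t) * f x + t * f y"
    by simp
qed simp

subsection \<open>Convex monomials\<close>

lemma monomial_single_variable:
  fixes x :: "'b::comm_semiring_1 ^ 'n"
  assumes "\<And>j. j \<noteq> i \<Longrightarrow> d j = 0"
  shows "(\<Prod>j\<in>UNIV. x $ j ^ d j) = x $ i ^ d i"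
  using prod.remove[of UNIV i "\<lambda>j. x $ j ^ d j"] assms by simp

lemma convex_monomial_cases:
  fixes a :: real and d :: "'n::finite \<Rightarrow> nat"
  assumes a: "a \<noteq> 0" and f_def: "f = (\<lambda>x. a * (\<Prod>i\<in>UNIV. x $ i ^ d i))"
    and conv: "convex_on UNIV (f :: real ^ 'n \<Rightarrow> real)" and deg: "(\<Sum>i\<in>UNIV. d i) \<ge> 2"
  obtains j where "f = (\<lambda>x. a * x $ j ^ d j)" "a > 0" "even (d j)"
proof -
  define D where "D = (\<Sum>i\<in>UNIV. d i)"
  define e :: "real ^ 'n" where "e = (\<chi> i. 1)"
  \<comment> \<open>Midpoint convexity with doubled endpoints, so that the midpoint is
    \<open>x + y\<close>.\<close>
  have mid: "f (x + y) \<le> (f (2 *\<^sub>R x) + f (2 *\<^sub>R y)) / 2" for x y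
    using convex_onD[OF conv, of "1/2" "2 *\<^sub>R x" "2 *\<^sub>R y"] by (simp add: field_simps)
  have diag: "f (s *\<^sub>R e) = a * s ^ D" for s
    by (simp add: f_def e_def D_def power_sum)
  have pow: "(2::real) ^ D \<ge> 4"
    using power_increasing[of 2 D "2::real"] deg by (simp add: D_def)
  have D0: "D \<noteq> 0" using deg D_def by linarith
  \<comment> \<open>The midpoint of 0 and \<open>2 *\<^sub>R e\<close> is \<open>e\<close>, and
    \<open>f\<close> vanishes at 0 because \<open>D\<close> is positive. As
    \<open>2 ^ D > 2\<close>, the resulting inequality forces the sign of \<open>a\<close>.\<close>
  then have "a \<le> a * 2 ^ D / 2"
    using mid[of "1 *\<^sub>R e" "0 *\<^sub>R e"] diag[of 1] diag[of 2] diag[of 0]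
    by (simp add: power_0_left)
  then have "0 \<le> a * (2 ^ D - 2)" by (simp add: algebra_simps)
  then have pos: "a > 0"
    using a pow by (simp add: zero_le_mult_iff)
  obtain i where i: "d i \<noteq> 0"
    using D0 unfolding D_def by (metis sum.neutral)
  have others: "d j = 0" if "j \<noteq> i" for j
  proof (rule ccontr)
    assume j: "d j \<noteq> 0"
    \<comment> \<open>The doubled points have a zero coordinate at \<open>j\<close> and at
      \<open>i\<close> respectively, and \<open>x + y = e\<close>.\<close>
    define x y where "x = (1/2) *\<^sub>R (e + axis i 1 - axis j 1)"
      and "y = (1/2) *\<^sub>R (e - axis i 1 + axis j 1)"
    have zero: "f z = 0" if "z $ k = 0" "d k \<noteq> 0" for z k
      using that unfolding f_def by auto
    have "f (2 *\<^sub>R x) = 0" "f (2 *\<^sub>R y) = 0"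
      using zero[of "2 *\<^sub>R x" j] zero[of "2 *\<^sub>R y" i] i j \<open>j \<noteq> i\<close>
      by (auto simp: x_def y_def e_def axis_def)
    moreover have "x + y = e"
      by (simp add: x_def y_def vec_eq_iff field_simps)
    ultimately have "f e \<le> 0" using mid[of x y] by simp
    then show False using diag[of 1] pos by simp
  qed
  have single: "f = (\<lambda>x. a * x $ i ^ d i)"
    by (simp add: f_def monomial_single_variable[of i d] others)
  have "D = d i"
    using sum.remove[of UNIV i d] others by (simp add: D_def)
  moreover have "even D"
  proof (rule ccontr)
    assume odd: "odd D"
    \<comment> \<open>The same comparison on the opposite half of the diagonal, between 0 and
      \<open>- 2 *\<^sub>R e\<close>; an odd degree reverses the sign of \<open>a\<close>.\<close>
    then have "- a \<le> - (a * 2 ^ D) / 2"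
      using mid[of "(-1) *\<^sub>R e" "0 *\<^sub>R e"] diag[of "-1"] diag[of "-2"] diag[of 0] D0
      by (simp add: power_0_left)
    then have "a * (2 ^ D - 2) \<le> 0" by (simp add: algebra_simps)
    moreover have "a * (2 ^ D - 2) > 0" using pos pow by simp
    ultimately show False by simp
  qed
  ultimately show thesis using that[OF single pos] by simp
qed

lemma convex_on_even_power_coordinate:
  fixes a :: real
  assumes "a > 0" "even k"
  shows "convex_on UNIV (\<lambda>x::real^'n. a * x $ j ^ k)"
proof (rule convex_onI)
  fix t and x y :: "real ^ 'n" assume t: "0 < t" "t < (1::real)"
  have "convex_on UNIV (\<lambda>s::real. a * s ^ k)"
    using assms by (intro convex_on_cmul convex_power_even) auto
  from convex_onD[OF this, of t "x $ j" "y $ j"] t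
  show "a * ((1 - t) *\<^sub>R x + t *\<^sub>R y) $ j ^ k \<le> (1 - t) * (a * x $ j ^ k) + t * (a * y $ j ^ k)"
    by simp
qed simp

lemma convex_on_linear_coordinate: "convex_on UNIV (\<lambda>x::real^'n. a * x $ j)"
  by (rule convex_onI) (simp_all add: algebra_simps)

text \<open>The cases go by total degree. In degree 1 the monomial is linear, hence convex for
  either sign of \<open>a\<close>. Constants are convex too: positive ones fall under the first
  alternative with the even exponent 0, negative ones need the last.\<close>

lemma convex_monomial_iff:
  fixes a :: real and d :: "'n::finite \<Rightarrow> nat" and f :: "real ^ 'n \<Rightarrow> real"
  assumes "a \<noteq> 0" and f_def: "f = (\<lambda>x. a * (\<Prod>i\<in>UNIV. x $ i ^ d i))"
  shows "convex_on UNIV f \<longleftrightarrow>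
      (\<exists>j. f = (\<lambda>x. a * x $ j ^ d j) \<and> a > 0 \<and> even (d j)) \<or>
      (\<Sum>i\<in>UNIV. d i) = 1 \<or> ((\<Sum>i\<in>UNIV. d i) = 0 \<and> a < 0)" (is "_ \<longleftrightarrow> ?even \<or> ?lin \<or> ?const")
proof
  assume conv: "convex_on UNIV f"
  consider "(\<Sum>i\<in>UNIV. d i) = 0" | "?lin" | "(\<Sum>i\<in>UNIV. d i) \<ge> 2" by linarith
  then show "?even \<or> ?lin \<or> ?const"
  proof cases
    case 1
    \<comment> \<open>All exponents vanish, so any index serves and only the sign of
      \<open>a\<close> distinguishes the alternatives.\<close>
    then have "f = (\<lambda>x. a * x $ j ^ d j) \<and> even (d j)" for j by (simp add: f_def)
    then show ?thesis using assms(1) 1 by (meson linorder_neqE)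
  next
    case 3
    from convex_monomial_cases[OF assms conv this] show ?thesis by blast
  qed blast
next
  assume "?even \<or> ?lin \<or> ?const"
  then consider (even) j where "f = (\<lambda>x. a * x $ j ^ d j)" "a > 0" "even (d j)" | (lin) "?lin" | (const) "?const"
    by blast
  then show "convex_on UNIV f"
  proof cases
    case even
    then show ?thesis using convex_on_even_power_coordinate by metis
  next
    case lin
    then obtain i where "d i = 1" "\<And>j. j \<noteq> i \<Longrightarrow> d j = 0"
      using sum_eq_1_iff[of UNIV d] by auto
    then show ?thesis
      using convex_on_linear_coordinate[of a i]
      by (simp add: f_def monomial_single_variable[of i d])
  next
    case const
    then show ?thesis by (simp add: f_def convex_on_const)
  qed
qed

theorem theorem7p4:
  fixes a :: real and d :: "'n::finite \<Rightarrow> nat" and f :: "real ^ 'n \<Rightarrow> real"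
  assumes "a \<noteq> 0"
    and "f = (\<lambda>x. a * (\<Prod>i\<in>UNIV. x $ i ^ d i))"
  shows "((\<exists>nabla. torsion_free_connection nabla \<and> g_convex nabla f) \<longleftrightarrow> convex_on UNIV f) \<and>
    (convex_on UNIV f \<longleftrightarrow>
      (\<exists>j. f = (\<lambda>x. a * x $ j ^ d j) \<and> a > 0 \<and> even (d j)) \<or>
      (\<Sum>i\<in>UNIV. d i) = 1 \<or> ((\<Sum>i\<in>UNIV. d i) = 0 \<and> a < 0))"
proof -
  have smooth: "smooth f" unfolding assms(2) by (rule smooth_monomial)
  \<comment> \<open>The exponent of homogeneity is the total degree.\<close>
  have hom: "f (c *\<^sub>R x) = c ^ (\<Sum>i\<in>UNIV. d i) * f x" for c x
    by (simp add: assms(2) power_mult_distrib prod.distrib power_sum)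
  have "convex_on UNIV f" if "torsion_free_connection nabla" "g_convex nabla f" for nabla
    using g_convex_homogeneous_imp_convex[OF _ that(2) hom] torsion_free_connection.axioms(1)[OF that(1)]
    by blast
  moreover have "g_convex flat_connection f" if "convex_on UNIV f"
    using convex_imp_g_convex_flat_connection[OF smooth that] .
  ultimately have "(\<exists>nabla. torsion_free_connection nabla \<and> g_convex nabla f) \<longleftrightarrow> convex_on UNIV f"
    using torsion_free_flat_connection by blast
  with convex_monomial_iff[OF assms] show ?thesis by (rule conjI[rotated])
qed

end
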